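(* Let $\mathcal A$ be a real tensor of size $m\times n\times p$ with T-SVD $\mathcal A=\mathcal U*\mathcal S*\mathcal V^H$ and T-CSVD $$\mathcal A=\mathcal U_{(r)}*\mathcal S_{(r)}*\mathcal V_{(r)}^H .$$ Then the Moore-Penrose inverse of $\mathcal A$ is given by $$\mathcal A^\dagger=\mathcal V_{(r)}*\mathcal S_{(r)}^\dagger*\mathcal U_{(r)}^H .$$
   Context: T-product. For $\mathcal A\in\mathbb C^{m\times n\times p}$ with frontal slices $A^{(1)},\dots,A^{(p)}\in\mathbb C^{m\times n}$, $\mathrm{unfold}(\mathcal A)\in\mathbb C^{mp\times n}$ is the vertical stack of $A^{(1)},\dots,A^{(p)}$, $\mathrm{fold}$ is its inverse, and $\mathrm{bcirc}(\mathcal A)\in\mathbb C^{mp\times np}$ is the block circulant matrix whose $(a,b)$ block is $A^{(((a-b)\bmod p)+1)}$; $\mathrm{bcirc}^{-1}$ is the inverse of $\mathrm{bcirc}$ on its image. For $\mathcal B\in\mathbb C^{n\times s\times p}$, $\mathcal A*\mathcal B=\mathrm{fold}(\mathrm{bcirc}(\mathcal A)\,\mathrm{unfold}(\mathcal B))$. $\mathcal A^H$ is obtained by conjugate transposing each frontal slice and reversing the order of slices $2,\dots,p$. The identity tensor has first frontal slice the identity matrix and other slices zero; $\mathcal Q$ is unitary if $\mathcal Q^H*\mathcal Q=\mathcal Q*\mathcal Q^H$ is the identity tensor. The Moore-Penrose inverse is $\mathcal A^\dagger=\mathrm{bcirc}^{-1}((\mathrm{bcirc}(\mathcal A))^\dagger)$.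 T-SVD and T-CSVD. $F_p=p^{-1/2}(\omega^{jk})_{j,k=0}^{p-1}$ with $\omega=e^{-2\pi\mathbf i/p}$. A T-SVD is $\mathcal A=\mathcal U*\mathcal S*\mathcal V^H$ with $\mathcal U,\mathcal V$ unitary, $\mathcal S$ F-diagonal (every frontal slice diagonal), $\mathrm{bcirc}(\mathcal U)=(F_p\otimes I_m)\mathrm{diag}(U_1,\dots,U_p)(F_p^H\otimes I_m)$, $\mathrm{bcirc}(\mathcal S)=(F_p\otimes I_m)\mathrm{diag}(\Sigma_1,\dots,\Sigma_p)(F_p^H\otimes I_n)$, $\mathrm{bcirc}(\mathcal V)=(F_p\otimes I_n)\mathrm{diag}(V_1,\dots,V_p)(F_p^H\otimes I_n)$, where $U_i,V_i$ are unitary and $\Sigma_i\in\mathbb R^{m\times n}$ is diagonal with nonnegative nonincreasing diagonal entries $c_1^{(i)}\ge c_2^{(i)}\ge\cdots$. Let $r=\max_i\mathrm{rank}\,\Sigma_i$ (tubal rank). The T-CSVD factors $\mathcal U_{(r)}\in\mathbb C^{m\times r\times p}$, $\mathcal S_{(r)}\in\mathbb C^{r\times r\times p}$, $\mathcal V_{(r)}\in\mathbb C^{n\times r\times p}$ are given by $\mathrm{bcirc}(\mathcal U_{(r)})=(F_p\otimes I_m)\mathrm{diag}((U_1)_r,\dots,(U_p)_r)(F_p^H\otimes I_r)$, $\mathrm{bcirc}(\mathcal S_{(r)})=(F_p\otimes I_r)\mathrm{diag}((\Sigma_1)_r,\dots,(\Sigma_p)_r)(F_p^H\otimes I_r)$,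 $\mathrm{bcirc}(\mathcal V_{(r)})=(F_p\otimes I_n)\mathrm{diag}((V_1)_r,\dots,(V_p)_r)(F_p^H\otimes I_r)$, where $(U_i)_r,(V_i)_r$ consist of the first $r$ columns of $U_i,V_i$ and $(\Sigma_i)_r=\mathrm{diag}(c_1^{(i)},\dots,c_r^{(i)})$; some $c_j^{(i)}$ may be zero. *)

theory Defs
  imports
    Complex_Main
    "Jordan_Normal_Form.Matrix"
    "Jordan_Normal_Form.Schur_Decomposition"
    "Jordan_Normal_Form.DL_Rank"
begin

section \<open>Matrices\<close>

definition kronecker :: "'a :: semiring_0 mat \<Rightarrow> 'a mat \<Rightarrow> 'a mat" where
  "kronecker A B = mat (dim_row A * dim_row B) (dim_col A * dim_col B)
     (\<lambda>(i, j). A $$ (i div dim_row B, j div dim_col B) * B $$ (i mod dim_row B, j mod dim_col B))"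

definition unitary_mat :: "nat \<Rightarrow> complex mat \<Rightarrow> bool" where
  "unitary_mat n Q \<longleftrightarrow> Q \<in> carrier_mat n n \<and> mat_adjoint Q * Q = 1\<^sub>m n \<and> Q * mat_adjoint Q = 1\<^sub>m n"

definition is_mp_inverse :: "complex mat \<Rightarrow> complex mat \<Rightarrow> bool" where
  "is_mp_inverse A X \<longleftrightarrow> X \<in> carrier_mat (dim_col A) (dim_row A) \<and>
     A * X * A = A \<and> X * A * X = X \<and>
     mat_adjoint (A * X) = A * X \<and> mat_adjoint (X * A) = X * A"

definition mp_inverse :: "complex mat \<Rightarrow> complex mat" where
  "mp_inverse A = (THE X. is_mp_inverse A X)"

definition dft_mat :: "nat \<Rightarrow> complex mat" where
  "dft_mat p = mat p p (\<lambda>(j, k).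
     complex_of_real (1 / sqrt (real p)) * exp (- (2 * complex_of_real pi * \<i> / of_nat p)) ^ (j * k))"

text \<open>The product of \<open>F\<^sub>p \<otimes> I\<^sub>m\<close>, the block diagonal matrix with the \<open>m \<times> n\<close> blocks
  \<open>D 0, \<dots>, D (p - 1)\<close>, and \<open>F\<^sub>p\<^sup>H \<otimes> I\<^sub>n\<close>.\<close>

definition block_dft :: "nat \<Rightarrow> nat \<Rightarrow> nat \<Rightarrow> (nat \<Rightarrow> complex mat) \<Rightarrow> complex mat" where
  "block_dft m n p D =
     kronecker (dft_mat p) (1\<^sub>m m) * diag_block_mat (map D [0..<p]) *
     kronecker (mat_adjoint (dft_mat p)) (1\<^sub>m n)"

definition first_cols :: "nat \<Rightarrow> 'a mat \<Rightarrow> 'a mat" where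
  "first_cols r A = mat_of_cols (dim_row A) (take r (cols A))"

section \<open>Third-order tensors and the T-product\<close>

text \<open>An \<open>m \<times> n \<times> p\<close> tensor is the list of its \<open>p\<close> frontal slices, so slice \<open>k\<close> of the usual
  one-based numbering is \<open>A ! (k - 1)\<close>.  The sizes \<open>m\<close> and \<open>n\<close> are read off the first slice, which
  is meaningful for \<open>p > 0\<close>.\<close>

type_synonym 'a tensor = "'a mat list"

definition carrier_tensor :: "nat \<Rightarrow> nat \<Rightarrow> nat \<Rightarrow> 'a tensor set" where
  "carrier_tensor m n p = {A. length A = p \<and> set A \<subseteq> carrier_mat m n}"

definition tdim_row :: "'a tensor \<Rightarrow> nat" where
  "tdim_row A = dim_row (hd A)"

definition tdim_col :: "'a tensor \<Rightarrow> nat" where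
  "tdim_col A = dim_col (hd A)"

definition real_tensor :: "complex tensor \<Rightarrow> bool" where
  "real_tensor A \<longleftrightarrow> (\<forall>M\<in>set A. elements_mat M \<subseteq> \<real>)"

definition f_diagonal :: "'a :: zero tensor \<Rightarrow> bool" where
  "f_diagonal A \<longleftrightarrow> (\<forall>M\<in>set A. diagonal_mat M)"

definition unfold_tensor :: "'a tensor \<Rightarrow> 'a mat" where
  "unfold_tensor A = mat (tdim_row A * length A) (tdim_col A)
     (\<lambda>(i, j). (A ! (i div tdim_row A)) $$ (i mod tdim_row A, j))"

text \<open>The number \<open>m\<close> of rows and \<open>p\<close> of slices cannot be recovered from the stacked matrix.\<close>

definition fold_tensor :: "nat \<Rightarrow> nat \<Rightarrow> 'a mat \<Rightarrow> 'a tensor" where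
  "fold_tensor m p M = map (\<lambda>k. mat m (dim_col M) (\<lambda>(i, j). M $$ (k * m + i, j))) [0..<p]"

text \<open>The summand \<open>length A\<close> in the slice index keeps the subtraction on \<open>nat\<close> from truncating.\<close>

definition bcirc :: "'a tensor \<Rightarrow> 'a mat" where
  "bcirc A = mat (tdim_row A * length A) (tdim_col A * length A)
     (\<lambda>(i, j). (A ! ((i div tdim_row A + length A - j div tdim_col A) mod length A)) $$
        (i mod tdim_row A, j mod tdim_col A))"

definition bcirc_inv :: "nat \<Rightarrow> nat \<Rightarrow> nat \<Rightarrow> 'a mat \<Rightarrow> 'a tensor" where
  "bcirc_inv m n p = the_inv_into (carrier_tensor m n p) bcirc"

definition tprod :: "'a :: semiring_0 tensor \<Rightarrow> 'a tensor \<Rightarrow> 'a tensor" (infixl "*\<^sub>t" 70) where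
  "A *\<^sub>t B = fold_tensor (tdim_row A) (length A) (bcirc A * unfold_tensor B)"

definition tensor_adjoint :: "complex tensor \<Rightarrow> complex tensor" where
  "tensor_adjoint A = map mat_adjoint (hd A # rev (tl A))"

definition id_tensor :: "nat \<Rightarrow> nat \<Rightarrow> complex tensor" where
  "id_tensor n p = 1\<^sub>m n # replicate (p - 1) (0\<^sub>m n n)"

definition unitary_tensor :: "nat \<Rightarrow> nat \<Rightarrow> complex tensor \<Rightarrow> bool" where
  "unitary_tensor n p Q \<longleftrightarrow> Q \<in> carrier_tensor n n p \<and>
     tensor_adjoint Q *\<^sub>t Q = id_tensor n p \<and> Q *\<^sub>t tensor_adjoint Q = id_tensor n p"

definition tensor_mp_inverse :: "complex tensor \<Rightarrow> complex tensor" where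
  "tensor_mp_inverse A = bcirc_inv (tdim_col A) (tdim_row A) (length A) (mp_inverse (bcirc A))"

section \<open>T-SVD and T-CSVD\<close>

definition t_svd ::
  "nat \<Rightarrow> nat \<Rightarrow> nat \<Rightarrow> complex tensor \<Rightarrow> complex tensor \<Rightarrow> complex tensor \<Rightarrow> complex tensor \<Rightarrow>
   (nat \<Rightarrow> complex mat) \<Rightarrow> (nat \<Rightarrow> real mat) \<Rightarrow> (nat \<Rightarrow> complex mat) \<Rightarrow> bool" where
  "t_svd m n p A U S V Us \<Sigma>s Vs \<longleftrightarrow>
     unitary_tensor m p U \<and> unitary_tensor n p V \<and>
     S \<in> carrier_tensor m n p \<and> f_diagonal S \<and>
     A = U *\<^sub>t S *\<^sub>t tensor_adjoint V \<and>
     bcirc U = block_dft m m p Us \<and>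
     bcirc S = block_dft m n p (\<lambda>i. map_mat complex_of_real (\<Sigma>s i)) \<and>
     bcirc V = block_dft n n p Vs \<and>
     (\<forall>i<p. unitary_mat m (Us i) \<and> unitary_mat n (Vs i) \<and>
        \<Sigma>s i \<in> carrier_mat m n \<and> diagonal_mat (\<Sigma>s i) \<and>
        (\<forall>j<min m n. \<Sigma>s i $$ (j, j) \<ge> 0) \<and>
        (\<forall>j k. j \<le> k \<and> k < min m n \<longrightarrow> \<Sigma>s i $$ (k, k) \<le> \<Sigma>s i $$ (j, j)))"

definition tubal_rank :: "nat \<Rightarrow> nat \<Rightarrow> (nat \<Rightarrow> real mat) \<Rightarrow> nat" where
  "tubal_rank m p \<Sigma>s = Max ((\<lambda>i. vec_space.rank m (\<Sigma>s i)) ` {..<p})"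

definition t_csvd ::
  "nat \<Rightarrow> nat \<Rightarrow> nat \<Rightarrow> nat \<Rightarrow> complex tensor \<Rightarrow> complex tensor \<Rightarrow> complex tensor \<Rightarrow> complex tensor \<Rightarrow>
   (nat \<Rightarrow> complex mat) \<Rightarrow> (nat \<Rightarrow> real mat) \<Rightarrow> (nat \<Rightarrow> complex mat) \<Rightarrow> bool" where
  "t_csvd m n p r A Ur Sr Vr Us \<Sigma>s Vs \<longleftrightarrow>
     Ur \<in> carrier_tensor m r p \<and> Sr \<in> carrier_tensor r r p \<and> Vr \<in> carrier_tensor n r p \<and>
     bcirc Ur = block_dft m r p (\<lambda>i. first_cols r (Us i)) \<and>
     bcirc Sr = block_dft r r p (\<lambda>i. mat_diag r (\<lambda>j. complex_of_real (\<Sigma>s i $$ (j, j)))) \<and>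
     bcirc Vr = block_dft n r p (\<lambda>i. first_cols r (Vs i)) \<and>
     A = Ur *\<^sub>t Sr *\<^sub>t tensor_adjoint Vr"

end

theory Submission
  imports Defs
begin

text \<open>The map \<open>bcirc\<close> is injective and turns the T-product and the tensor adjoint into the matrix
  product and the matrix adjoint.  The block matrices of the truncated factors \<open>U\<close> and \<open>V\<close> have
  orthonormal columns, because the truncated blocks do and conjugation with Fourier matrices
  preserves products and adjoints; and if \<open>T\<close> is the Moore--Penrose inverse of \<open>S\<close>, then that of
  \<open>U S V\<^sup>H\<close> is \<open>V T U\<^sup>H\<close>.  The diagonal blocks of \<open>S\<close> are inverted entrywise, and the result is again
  block circulant, because every block diagonal matrix becomes block circulant after conjugation
  with Fourier matrices.\<close>

section \<open>Block matrices\<close>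

lemma block_index_less:
  fixes a i m p :: nat
  assumes "a < p" "i < m"
  shows "a * m + i < m * p"
proof -
  have "a * m + i < Suc a * m" using assms(2) by simp
  also have "\<dots> \<le> p * m" using assms(1) by (intro mult_right_mono) auto
  finally show ?thesis by (simp add: mult.commute)
qed

lemma sum_blocks:
  fixes f :: "nat \<Rightarrow> 'a :: comm_monoid_add"
  shows "(\<Sum>x = 0..<n * p. f x) = (\<Sum>c<p. \<Sum>l<n. f (c * n + l))"
proof -
  have "(\<Sum>x = 0..<n * p. f x) = (\<Sum>c<p. sum f {c * n..<c * n + n})"
    by (simp add: sum.nat_group mult.commute atLeast0LessThan)
  moreover have "sum f {c * n..<c * n + n} = (\<Sum>l<n. f (c * n + l))" for c
    using sum.shift_bounds_nat_ivl[of f 0 "c * n" n]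
    by (simp add: atLeast0LessThan add.commute)
  ultimately show ?thesis by simp
qed

text \<open>Quotient and remainder write every row index as \<open>a * m + i\<close> and every
  column index as \<open>b * n + j\<close>. The identities for \<open>bcirc\<close> and
  \<open>block_dft\<close> are checked in this form, because their entries are described by block
  and by position inside the block.\<close>

lemma eq_block_matI:
  assumes "A \<in> carrier_mat (m * p) (n * p)" "B \<in> carrier_mat (m * p) (n * p)"
    and "\<And>a b i j. a < p \<Longrightarrow> b < p \<Longrightarrow> i < m \<Longrightarrow> j < n \<Longrightarrow>
      A $$ (a * m + i, b * n + j) = B $$ (a * m + i, b * n + j)"
  shows "A = B"
proof (rule eq_matI)
  fix x y
  assume "x < dim_row B" "y < dim_col B"
  then have x: "x < m * p" and y: "y < n * p" using assms(2) by auto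
  \<comment> \<open>The existence of an index rules out empty blocks, so division by
    \<open>m\<close> and \<open>n\<close> behaves as expected.\<close>
  then have "m > 0" "n > 0" by (auto intro: gr0I)
  with x y have "x div m < p" "y div n < p" "x mod m < m" "y mod n < n"
    by (auto simp: div_less_iff_less_mult mult.commute)
  from assms(3)[OF this] show "A $$ (x, y) = B $$ (x, y)"
    by simp
qed (use assms in auto)

lemma index_mult_blocks:
  assumes "X \<in> carrier_mat (m * p) (n * q)" "Y \<in> carrier_mat (n * q) k"
    and "x < m * p" "y < k"
  shows "(X * Y) $$ (x, y) = (\<Sum>c<q. \<Sum>l<n. X $$ (x, c * n + l) * Y $$ (c * n + l, y))"
proof -
  have "(X * Y) $$ (x, y) = (\<Sum>z = 0..<n * q. X $$ (x, z) * Y $$ (z, y))"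
    using assms by (simp add: scalar_prod_def)
  then show ?thesis by (simp add: sum_blocks)
qed

lemma kronecker_one_index:
  fixes A :: "'a :: semiring_1 mat"
  assumes "A \<in> carrier_mat p q" "a < p" "b < q" "i < m" "j < m"
  shows "kronecker A (1\<^sub>m m) $$ (a * m + i, b * m + j) = (if i = j then A $$ (a, b) else 0)"
  using assms block_index_less[OF assms(2,4)] block_index_less[OF assms(3,5)]
  by (simp add: kronecker_def mult.commute)

lemma diag_block_mat_carrier:
  assumes "\<And>k. k < p \<Longrightarrow> D k \<in> carrier_mat m n"
  shows "diag_block_mat (map D [0..<p]) \<in> carrier_mat (m * p) (n * p)"
proof -
  have "map (dim_row \<circ> D) [0..<p] = map (\<lambda>_. m) [0..<p]"
    "map (dim_col \<circ> D) [0..<p] = map (\<lambda>_. n) [0..<p]"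
    using carrier_matD[OF assms] by auto
  then show ?thesis
    by (auto simp: dim_diag_block_mat sum_list_triv mult.commute simp del: map_eq_conv)
qed

text \<open>Induction on the number of blocks: the last block is split off as the lower right corner
  of a \<open>four_block_mat\<close> with zero off-diagonal corners, and comparing \<open>a\<close>
  and \<open>b\<close> with \<open>p\<close> selects the corner.\<close>

lemma diag_block_mat_index:
  assumes "\<And>k. k < p \<Longrightarrow> D k \<in> carrier_mat m n"
    and "a < p" "b < p" "i < m" "j < n"
  shows "diag_block_mat (map D [0..<p]) $$ (a * m + i, b * n + j)
    = (if a = b then D a $$ (i, j) else 0)"
  using assms
proof (induction p)
  case (Suc p)
  let ?B = "diag_block_mat (map D [0..<p])"
  have B: "?B \<in> carrier_mat (m * p) (n * p)"
    using Suc.prems(1) by (intro diag_block_mat_carrier) auto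
  have D: "D p \<in> carrier_mat m n" using Suc.prems(1) by simp
  have eq: "diag_block_mat (map D [0..<Suc p])
      = four_block_mat ?B (0\<^sub>m (m * p) n) (0\<^sub>m m (n * p)) (D p)"
    using B D by (simp add: diag_block_mat_last Let_def)
  have "a * m + i < m * p \<longleftrightarrow> a < p"
    using block_index_less[of a p i m] Suc.prems by (cases "a = p") (auto simp: mult.commute)
  moreover have "b * n + j < n * p \<longleftrightarrow> b < p"
    using block_index_less[of b p j n] Suc.prems by (cases "b = p") (auto simp: mult.commute)
  moreover have "a * m + i < m * Suc p" "b * n + j < n * Suc p"
    using block_index_less Suc.prems by blast+
  moreover have "a = p \<or> a < p" "b = p \<or> b < p" using Suc.prems by auto
  moreover have "dim_row ?B = m * p" "dim_col ?B = n * p" "dim_row (D p) = m" "dim_col (D p) = n"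
    using B D by auto
  ultimately show ?case
    unfolding eq using Suc.prems Suc.IH
    by (subst index_mat_four_block) (auto simp: mult.commute add.commute)
qed simp

section \<open>Adjoints and the Moore--Penrose inverse\<close>

lemma mat_adjoint_carrier [simp]:
  "A \<in> carrier_mat m n \<Longrightarrow> mat_adjoint A \<in> carrier_mat n m"
  by (auto simp: mat_adjoint_def)

lemma mat_adjoint_dim [simp]:
  "dim_row (mat_adjoint A) = dim_col A" "dim_col (mat_adjoint A) = dim_row A"
  by (auto simp: mat_adjoint_def)

lemma mat_adjoint_index [simp]:
  fixes A :: "complex mat"
  shows "i < dim_col A \<Longrightarrow> j < dim_row A \<Longrightarrow> mat_adjoint A $$ (i, j) = cnj (A $$ (j, i))"
  by (simp add: mat_adjoint_def mat_of_rows_index conjugate_complex_def)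

lemma mat_adjoint_adjoint [simp]:
  fixes A :: "complex mat"
  shows "mat_adjoint (mat_adjoint A) = A"
  by (rule eq_matI) auto

lemma mat_adjoint_mult:
  fixes A B :: "complex mat"
  assumes "A \<in> carrier_mat m n" "B \<in> carrier_mat n k"
  shows "mat_adjoint (A * B) = mat_adjoint B * mat_adjoint A"
  using assms by (intro eq_matI) (auto simp: scalar_prod_def mult.commute)

text \<open>Uniqueness of the Moore-Penrose inverse, which gives the \<open>THE\<close> in
  \<open>mp_inverse\<close> its value. For two candidates the Hermitian products
  \<open>A * X\<close> and \<open>A * Y\<close> absorb each other, hence coincide, and likewise
  \<open>X * A\<close> and \<open>Y * A\<close>.\<close>

lemma mp_inverse_eqI:
  assumes X: "is_mp_inverse A X"
  shows "mp_inverse A = X"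
  unfolding mp_inverse_def
proof (rule the_equality)
  fix Y
  assume Y: "is_mp_inverse A Y"
  define m n where "m = dim_row A" and "n = dim_col A"
  have A: "A \<in> carrier_mat m n" by (simp add: m_def n_def)
  have Xc: "X \<in> carrier_mat n m" and Yc: "Y \<in> carrier_mat n m"
    using X Y by (simp_all add: is_mp_inverse_def m_def n_def)
  note [simp] = A Xc Yc
  have AXA: "A * X * A = A" and XAX: "X * A * X = X"
    and AX: "mat_adjoint (A * X) = A * X" and XA: "mat_adjoint (X * A) = X * A"
    using X by (simp_all add: is_mp_inverse_def)
  have AYA: "A * Y * A = A" and YAY: "Y * A * Y = Y"
    and AY: "mat_adjoint (A * Y) = A * Y" and YA: "mat_adjoint (Y * A) = Y * A"
    using Y by (simp_all add: is_mp_inverse_def)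
  have AXc: "A * X \<in> carrier_mat m m" and AYc: "A * Y \<in> carrier_mat m m"
    and XAc: "X * A \<in> carrier_mat n n" and YAc: "Y * A \<in> carrier_mat n n"
    by (auto intro: mult_carrier_mat[OF A Xc] mult_carrier_mat[OF A Yc]
        mult_carrier_mat[OF Xc A] mult_carrier_mat[OF Yc A])
  have "A * X = (A * Y) * (A * X)"
    using assoc_mult_mat[OF AYc A Xc] AYA by simp
  \<comment> \<open>Taking adjoints swaps the two Hermitian factors, after which
    \<open>A * X * A = A\<close> absorbs the other one.\<close>
  then have "A * X = mat_adjoint ((A * Y) * (A * X))" using AX by simp
  also have "\<dots> = (A * X) * (A * Y)"
    using mat_adjoint_mult[OF AYc AXc] AX AY by simp
  also have "\<dots> = A * Y"
    using assoc_mult_mat[OF AXc A Yc] AXA by simp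
  finally have 1: "A * X = A * Y" .
  have "X * A = (X * A) * (Y * A)"
    using assoc_mult_mat[OF Xc A YAc] assoc_mult_mat[OF A Yc A] AYA by simp
  then have "X * A = mat_adjoint ((X * A) * (Y * A))" using XA by simp
  also have "\<dots> = (Y * A) * (X * A)"
    using mat_adjoint_mult[OF XAc YAc] XA YA by simp
  also have "\<dots> = Y * A"
    using assoc_mult_mat[OF Yc A XAc] assoc_mult_mat[OF A Xc A] AXA by simp
  finally have 2: "X * A = Y * A" .
  \<comment> \<open>The chain is \<open>Y = Y * A * Y = Y * A * X = X * A * X = X\<close>.\<close>
  show "Y = X"
    using XAX YAY 1 2 assoc_mult_mat[OF Yc A Xc] assoc_mult_mat[OF Yc A Yc] by simp
qed (fact X)

lemma mult_mat_assoc: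
  fixes A B C :: "'a :: semiring_0 mat"
  assumes "dim_col A = dim_row B" "dim_col B = dim_row C"
  shows "A * B * C = A * (B * C)"
  using assms by (intro assoc_mult_mat[of A _ _ B _ C]) auto

text \<open>Orthonormal columns make the inner factors cancel, so the two products become
  \<open>U * (S * T) * mat_adjoint U\<close> and \<open>V * (T * S) * mat_adjoint V\<close>. Each
  Penrose equation then reduces to the one for \<open>S\<close> and \<open>T\<close>.\<close>

lemma is_mp_inverse_isometry:
  assumes U: "U \<in> carrier_mat m r" "mat_adjoint U * U = 1\<^sub>m r"
    and V: "V \<in> carrier_mat n s" "mat_adjoint V * V = 1\<^sub>m s"
    and S: "S \<in> carrier_mat r s" and T: "is_mp_inverse S T"
  shows "is_mp_inverse (U * S * mat_adjoint V) (V * T * mat_adjoint U)"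
proof -
  have Tc: "T \<in> carrier_mat s r" using T S by (simp add: is_mp_inverse_def)
  \<comment> \<open>Stated for arbitrary outer factors, since it is applied with several
    combinations of \<open>U\<close> and \<open>V\<close>.\<close>
  have cancel: "(P * X * mat_adjoint Q) * (Q * Y * mat_adjoint R) = P * (X * Y) * mat_adjoint R"
    if P: "P \<in> carrier_mat a b" and X: "X \<in> carrier_mat b c" and Q: "Q \<in> carrier_mat d c"
      and QQ: "mat_adjoint Q * Q = 1\<^sub>m c" and Y: "Y \<in> carrier_mat c e" and R: "R \<in> carrier_mat f e"
    for P X Q Y R :: "complex mat" and a b c d e f
  proof -
    note d = carrier_matD[OF P] carrier_matD[OF X] carrier_matD[OF Q] carrier_matD[OF Y]
      carrier_matD[OF R]
    have "(P * X * mat_adjoint Q) * (Q * Y * mat_adjoint R)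
        = P * X * (mat_adjoint Q * Q * (Y * mat_adjoint R))"
      by (simp add: mult_mat_assoc d)
    also have "mat_adjoint Q * Q * (Y * mat_adjoint R) = Y * mat_adjoint R"
      unfolding QQ using Y R by (intro left_mult_one_mat[of _ _ f]) auto
    also have "P * X * (Y * mat_adjoint R) = P * (X * Y) * mat_adjoint R"
      by (simp add: mult_mat_assoc d)
    finally show ?thesis .
  qed
  have adj: "mat_adjoint (P * X * mat_adjoint P) = P * mat_adjoint X * mat_adjoint P"
    if P: "P \<in> carrier_mat a b" and X: "X \<in> carrier_mat b b" for P X :: "complex mat" and a b
  proof -
    have "mat_adjoint (P * X * mat_adjoint P) = P * (mat_adjoint X * mat_adjoint P)"
      using mat_adjoint_mult[OF mult_carrier_mat[OF P X] mat_adjoint_carrier[OF P]]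
        mat_adjoint_mult[OF P X] by simp
    then show ?thesis
      by (simp add: mult_mat_assoc carrier_matD[OF P] carrier_matD[OF X])
  qed
  note mp = T[unfolded is_mp_inverse_def]
  let ?A = "U * S * mat_adjoint V" and ?X = "V * T * mat_adjoint U"
  have AX: "?A * ?X = U * (S * T) * mat_adjoint U"
    using U V S Tc by (intro cancel)
  have XA: "?X * ?A = V * (T * S) * mat_adjoint V"
    using U V S Tc by (intro cancel)
  have ST: "S * T \<in> carrier_mat r r" and TS: "T * S \<in> carrier_mat s s"
    using S Tc by auto
  have "?A * ?X * ?A = ?A"
    unfolding AX using cancel[OF U(1) ST U(1) U(2) S V(1)] mp by simp
  moreover have "?X * ?A * ?X = ?X"
    unfolding XA using cancel[OF V(1) TS V(1) V(2) Tc U(1)] mp by simp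
  moreover have "mat_adjoint (?A * ?X) = ?A * ?X"
    unfolding AX using adj[OF U(1) ST] mp by simp
  moreover have "mat_adjoint (?X * ?A) = ?X * ?A"
    unfolding XA using adj[OF V(1) TS] mp by simp
  moreover have "?X \<in> carrier_mat (dim_col ?A) (dim_row ?A)"
    using U V S Tc by auto
  ultimately show ?thesis by (simp add: is_mp_inverse_def)
qed

text \<open>Zero entries are covered by the convention \<open>inverse 0 = 0\<close>.\<close>

lemma is_mp_inverse_diag:
  fixes f :: "nat \<Rightarrow> complex"
  shows "is_mp_inverse (mat_diag r f) (mat_diag r (\<lambda>i. inverse (f i)))"
proof -
  let ?D = "mat_diag r f" and ?E = "mat_diag r (\<lambda>i. inverse (f i))"
  \<comment> \<open>The projection onto the coordinates where \<open>f\<close> does not vanish; both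
    products of \<open>?D\<close> and \<open>?E\<close> equal it.\<close>
  let ?P = "mat_diag r (\<lambda>i. if f i = 0 then 0 else 1 :: complex)"
  have DE: "?D * ?E = ?P" and ED: "?E * ?D = ?P"
    unfolding mat_diag_diag by (rule arg_cong[where f = "mat_diag r"]; auto)+
  have PD: "?P * ?D = ?D" and PE: "?P * ?E = ?E"
    unfolding mat_diag_diag by (rule arg_cong[where f = "mat_diag r"]; auto)+
  have "mat_adjoint ?P = ?P"
    by (rule eq_matI) (auto simp: mat_diag_def)
  moreover have "?E \<in> carrier_mat (dim_col ?D) (dim_row ?D)" by (simp add: mat_diag_def)
  ultimately show ?thesis by (simp only: is_mp_inverse_def DE ED PD PE simp_thms)
qed

section \<open>Block circulant matrices\<close>

lemma carrier_tensorD: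
  assumes "A \<in> carrier_tensor m n p"
  shows "length A = p" "k < p \<Longrightarrow> A ! k \<in> carrier_mat m n"
    and "p > 0 \<Longrightarrow> tdim_row A = m" "p > 0 \<Longrightarrow> tdim_col A = n"
proof -
  show l: "length A = p" using assms by (auto simp: carrier_tensor_def)
  show n: "A ! k \<in> carrier_mat m n" if "k < p" for k
    using assms that by (auto simp: carrier_tensor_def)
  have "hd A \<in> carrier_mat m n" if "p > 0"
    using n[OF that] l that by (cases A) auto
  then show "p > 0 \<Longrightarrow> tdim_row A = m" "p > 0 \<Longrightarrow> tdim_col A = n"
    by (auto simp: tdim_row_def tdim_col_def)
qed

lemma bcirc_carrier:
  assumes "A \<in> carrier_tensor m n p" "p > 0"
  shows "bcirc A \<in> carrier_mat (m * p) (n * p)"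
  using carrier_tensorD[OF assms(1)] assms(2) by (simp add: bcirc_def)

lemma bcirc_index:
  assumes A: "A \<in> carrier_tensor m n p" and "a < p" "b < p" "i < m" "j < n"
  shows "bcirc A $$ (a * m + i, b * n + j) = A ! ((a + p - b) mod p) $$ (i, j)"
proof -
  have "p > 0" using assms by simp
  with assms block_index_less[of a p i m] block_index_less[of b p j n] show ?thesis
    by (simp add: bcirc_def carrier_tensorD[OF A])
qed

text \<open>The first block column of \<open>bcirc A\<close> lists the slices in order: block
  \<open>(k, 0)\<close> is slice \<open>k\<close>.\<close>

lemma bcirc_inj:
  assumes "p > 0"
  shows "inj_on bcirc (carrier_tensor m n p)"
proof (rule inj_onI)
  fix A B :: "'a tensor"
  assume A: "A \<in> carrier_tensor m n p" and B: "B \<in> carrier_tensor m n p"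
    and eq: "bcirc A = bcirc B"
  show "A = B"
  proof (rule nth_equalityI)
    fix k
    assume "k < length A"
    then have k: "k < p" using carrier_tensorD[OF A] by simp
    show "A ! k = B ! k"
    proof (rule eq_matI)
      fix i j
      assume "i < dim_row (B ! k)" "j < dim_col (B ! k)"
      then have ij: "i < m" "j < n" using carrier_tensorD(2)[OF B k] by auto
      show "A ! k $$ (i, j) = B ! k $$ (i, j)"
        using bcirc_index[OF A k assms ij] bcirc_index[OF B k assms ij] eq k by simp
    qed (use carrier_tensorD(2)[OF A k] carrier_tensorD(2)[OF B k] in auto)
  qed (use carrier_tensorD[OF A] carrier_tensorD[OF B] in simp)
qed

lemma tprod_carrier:
  assumes A: "A \<in> carrier_tensor m n p" and B: "B \<in> carrier_tensor n s p" and "p > 0"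
  shows "A *\<^sub>t B \<in> carrier_tensor m s p"
  using carrier_tensorD[OF A] carrier_tensorD[OF B] \<open>p > 0\<close>
  by (auto simp: tprod_def fold_tensor_def unfold_tensor_def carrier_tensor_def)

text \<open>The T-product is the cyclic convolution of the slices, with matrix multiplication as the
  product.\<close>

lemma tprod_index:
  assumes A: "A \<in> carrier_tensor m n p" and B: "B \<in> carrier_tensor n s p"
    and k: "k < p" and i: "i < m" and j: "j < s"
  shows "(A *\<^sub>t B) ! k $$ (i, j)
    = (\<Sum>c<p. \<Sum>l<n. A ! ((k + p - c) mod p) $$ (i, l) * B ! c $$ (l, j))"
proof -
  have p: "p > 0" using k by simp
  have "unfold_tensor B \<in> carrier_mat (n * p) s"
    using carrier_tensorD[OF B] p by (simp add: unfold_tensor_def)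
  note index_mult_blocks[OF bcirc_carrier[OF A p] this block_index_less[OF k i] j]
  moreover have "(A *\<^sub>t B) ! k $$ (i, j) = (bcirc A * unfold_tensor B) $$ (k * m + i, j)"
    using carrier_tensorD[OF A] carrier_tensorD[OF B] p k i j
    by (simp add: tprod_def fold_tensor_def unfold_tensor_def)
  moreover have "unfold_tensor B $$ (c * n + l, j) = B ! c $$ (l, j)" if "c < p" "l < n" for c l
    using carrier_tensorD[OF B] p that j block_index_less[OF that]
    by (simp add: unfold_tensor_def)
  ultimately show ?thesis
    using bcirc_index[OF A k _ i] by simp
qed

text \<open>Cyclic shifts of indices below \<open>p\<close> stay below \<open>2 * p\<close>, so this
  turns modular identities into case distinctions within linear arithmetic.\<close>

lemma mod_less_double:
  fixes x p :: nat
  shows "x < 2 * p \<Longrightarrow> x mod p = (if x < p then x else x - p)"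
  by (auto simp: le_mod_geq)

lemma bcirc_tprod:
  fixes A B :: "'a :: semiring_0 tensor"
  assumes A: "A \<in> carrier_tensor m n p" and B: "B \<in> carrier_tensor n s p" and p: "p > 0"
  shows "bcirc (A *\<^sub>t B) = bcirc A * bcirc B"
proof (rule eq_block_matI)
  note AB = tprod_carrier[OF A B p]
  show "bcirc (A *\<^sub>t B) \<in> carrier_mat (m * p) (s * p)" by (rule bcirc_carrier[OF AB p])
  show "bcirc A * bcirc B \<in> carrier_mat (m * p) (s * p)"
    using bcirc_carrier[OF A p] bcirc_carrier[OF B p] by simp
  fix a b i j
  assume a: "a < p" and b: "b < p" and i: "i < m" and j: "j < s"
  let ?k = "(a + p - b) mod p"
  have k: "?k < p" using p by simp
  have "bcirc (A *\<^sub>t B) $$ (a * m + i, b * s + j)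
      = (\<Sum>c<p. \<Sum>l<n. A ! ((?k + p - c) mod p) $$ (i, l) * B ! c $$ (l, j))"
    using bcirc_index[OF AB a b i j] tprod_index[OF A B k i j] by simp
  also have "\<dots> = (\<Sum>c<p. \<Sum>l<n. A ! ((a + p - c) mod p) $$ (i, l) * B ! ((c + p - b) mod p) $$ (l, j))"
  \<comment> \<open>The summation index is shifted cyclically by the block column \<open>b\<close>:
    \<open>c\<close> on the left corresponds to \<open>(c + b) mod p\<close> on the right, because
    \<open>(a - b) - c\<close> and \<open>a - (c + b)\<close> agree modulo \<open>p\<close>.\<close>
  proof (rule sum.reindex_bij_witness[of _ "\<lambda>c. (c + p - b) mod p" "\<lambda>c. (c + b) mod p"])
    fix c
    assume c: "c \<in> {..<p}"
    show "((c + b) mod p + p - b) mod p = c" "((c + p - b) mod p + b) mod p = c"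
      using b c by (auto simp: mod_less_double)
    show "(c + b) mod p \<in> {..<p}" "(c + p - b) mod p \<in> {..<p}" using p by auto
    have "(a + p - (c + b) mod p) mod p = (?k + p - c) mod p"
      using a b c by (auto simp: mod_less_double)
    moreover have "((c + b) mod p + p - b) mod p = c"
      using b c by (auto simp: mod_less_double)
    ultimately show "(\<Sum>l<n. A ! ((a + p - (c + b) mod p) mod p) $$ (i, l) * B ! (((c + b) mod p + p - b) mod p) $$ (l, j))
      = (\<Sum>l<n. A ! ((?k + p - c) mod p) $$ (i, l) * B ! c $$ (l, j))" by simp
  qed
  also have "\<dots> = (bcirc A * bcirc B) $$ (a * m + i, b * s + j)"
    using bcirc_index[OF A a _ i] bcirc_index[OF B _ b _ j]
    by (simp add: index_mult_blocks[OF bcirc_carrier[OF A p] bcirc_carrier[OF B p]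
          block_index_less[OF a i] block_index_less[OF b j]])
  finally show "bcirc (A *\<^sub>t B) $$ (a * m + i, b * s + j)
    = (bcirc A * bcirc B) $$ (a * m + i, b * s + j)" .
qed

text \<open>Fixing the first slice and reversing the others is the negation of the slice index
  modulo \<open>p\<close>.\<close>

lemma tensor_adjoint_index:
  assumes A: "A \<in> carrier_tensor m n p" and k: "k < p"
  shows "tensor_adjoint A ! k = mat_adjoint (A ! ((p - k) mod p))"
proof -
  have "A \<noteq> []" using carrier_tensorD(1)[OF A] k by auto
  then show ?thesis
    using carrier_tensorD(1)[OF A] k
    by (cases k) (auto simp: tensor_adjoint_def hd_conv_nth rev_nth nth_tl Suc_diff_Suc)
qed

lemma tensor_adjoint_carrier:
  assumes A: "A \<in> carrier_tensor m n p" and p: "p > 0"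
  shows "tensor_adjoint A \<in> carrier_tensor n m p"
proof -
  have len: "length (tensor_adjoint A) = p"
    using carrier_tensorD(1)[OF A] p by (simp add: tensor_adjoint_def)
  moreover have "tensor_adjoint A ! k \<in> carrier_mat n m" if "k < p" for k
    using tensor_adjoint_index[OF A that] carrier_tensorD(2)[OF A] p by simp
  ultimately show ?thesis
    by (auto simp: carrier_tensor_def in_set_conv_nth simp del: carrier_matD)
qed

text \<open>Transposing the block positions replaces \<open>a - b\<close> by \<open>b - a\<close>
  modulo \<open>p\<close>, which is the negation performed by \<open>tensor_adjoint\<close>.\<close>

lemma bcirc_adjoint:
  assumes A: "A \<in> carrier_tensor m n p" and p: "p > 0"
  shows "bcirc (tensor_adjoint A) = mat_adjoint (bcirc A)"
proof (rule eq_block_matI)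
  note A' = tensor_adjoint_carrier[OF A p]
  show "bcirc (tensor_adjoint A) \<in> carrier_mat (n * p) (m * p)" by (rule bcirc_carrier[OF A' p])
  show "mat_adjoint (bcirc A) \<in> carrier_mat (n * p) (m * p)"
    using bcirc_carrier[OF A p] by simp
  fix a b i j
  assume a: "a < p" and b: "b < p" and i: "i < n" and j: "j < m"
  have k: "(a + p - b) mod p < p" and l: "(b + p - a) mod p < p" using p by auto
  have "(p - (a + p - b) mod p) mod p = (b + p - a) mod p"
    using a b by (auto simp: mod_less_double)
  then show "bcirc (tensor_adjoint A) $$ (a * n + i, b * m + j)
      = mat_adjoint (bcirc A) $$ (a * n + i, b * m + j)"
    using bcirc_index[OF A' a b i j] bcirc_index[OF A b a j i] tensor_adjoint_index[OF A k]
      carrier_tensorD(2)[OF A l] bcirc_carrier[OF A p] i j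
      block_index_less[OF a i] block_index_less[OF b j]
    by simp
qed

text \<open>The preimage under \<open>bcirc\<close> is determined by injectivity once the matrix
  inverse is known to be block circulant; the witness \<open>X\<close> supplies this.\<close>

lemma tensor_mp_inverse_eqI:
  assumes A: "A \<in> carrier_tensor m n p" and X: "X \<in> carrier_tensor n m p" and p: "p > 0"
    and mp: "is_mp_inverse (bcirc A) (bcirc X)"
  shows "tensor_mp_inverse A = X"
  using the_inv_into_f_f[OF bcirc_inj[OF p] X] mp_inverse_eqI[OF mp] carrier_tensorD[OF A] p
  by (simp add: tensor_mp_inverse_def bcirc_inv_def)

section \<open>Block diagonalisation by the discrete Fourier transform\<close>

definition dft_root :: "nat \<Rightarrow> complex" where
  "dft_root p = exp (- (2 * complex_of_real pi * \<i> / of_nat p))"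

text \<open>The conjugate brings the negative angle into the form
  \<open>cis (2 * pi * k / p)\<close> used in \<open>bij_betw_roots_unity\<close>.\<close>

lemma dft_root_power: "dft_root p ^ k = cnj (cis (2 * pi * real k / real p))"
proof -
  have "dft_root p = cis (- (2 * pi / real p))"
    by (simp add: dft_root_def cis_conv_exp mult_ac)
  then show ?thesis
    by (simp add: Complex.DeMoivre cis_cnj mult_ac)
qed

lemma dft_root_unity: "p > 0 \<Longrightarrow> dft_root p ^ p = 1"
  by (simp add: dft_root_power)

lemma dft_root_cnj: "cnj (dft_root p) * dft_root p = 1"
  using complex_norm_square[of "dft_root p"] dft_root_power[of p 1]
  by (simp add: mult.commute)

lemma dft_root_inj:
  assumes "k < p" "l < p" "dft_root p ^ k = dft_root p ^ l"
  shows "k = l"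
proof -
  have "inj_on (\<lambda>k. cis (2 * pi * real k / real p)) {..<p}"
    using bij_betw_roots_unity[of p] assms by (auto simp: bij_betw_def)
  with assms show ?thesis by (auto simp: dft_root_power dest: inj_onD)
qed

lemma dft_mat_index:
  assumes "j < p" "k < p"
  shows "dft_mat p $$ (j, k) = complex_of_real (1 / sqrt (real p)) * dft_root p ^ (j * k)"
  using assms by (simp add: dft_mat_def dft_root_def)

lemma dft_mat_carrier: "dft_mat p \<in> carrier_mat p p"
  by (simp add: dft_mat_def)

text \<open>Up to the factor \<open>1 / p\<close> the inner product of two columns is a geometric
  sum over a \<open>p\<close>-th root of unity \<open>z\<close>. All terms are 1 if the columns
  coincide; otherwise \<open>z \<noteq> 1\<close> and the sum vanishes.\<close>

lemma dft_mat_orthonormal: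
  assumes k: "k < p" and l: "l < p"
  shows "(\<Sum>b<p. cnj (dft_mat p $$ (b, k)) * dft_mat p $$ (b, l)) = (if k = l then 1 else 0)"
proof -
  let ?w = "dft_root p"
  \<comment> \<open>This is the power of the root with exponent \<open>l - k\<close>; the conjugate
    stands for the inverse, so that exponents remain natural numbers.\<close>
  define z where "z = cnj (?w ^ k) * ?w ^ l"
  have p: "p > 0" using k by simp
  have sq: "complex_of_real (1 / sqrt (real p)) * complex_of_real (1 / sqrt (real p)) = 1 / of_nat p"
    unfolding of_real_mult[symmetric] by simp
  have "cnj (dft_mat p $$ (b, k)) * dft_mat p $$ (b, l) = 1 / of_nat p * z ^ b" if "b < p" for b
  proof -
    have "cnj (dft_mat p $$ (b, k)) * dft_mat p $$ (b, l)
        = (complex_of_real (1 / sqrt (real p)) * complex_of_real (1 / sqrt (real p))) *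
          (cnj (?w ^ (b * k)) * ?w ^ (b * l))"
      using that k l by (simp only: dft_mat_index complex_cnj_mult complex_cnj_complex_of_real mult_ac)
    also have "cnj (?w ^ (b * k)) * ?w ^ (b * l) = z ^ b"
      by (simp add: z_def power_mult_distrib power_mult[symmetric] mult.commute)
    finally show ?thesis by (simp only: sq)
  qed
  then have sum: "(\<Sum>b<p. cnj (dft_mat p $$ (b, k)) * dft_mat p $$ (b, l)) = 1 / of_nat p * (\<Sum>b<p. z ^ b)"
    by (simp add: sum_distrib_left)
  show ?thesis
  proof (cases "k = l")
    case True
    have "z = (cnj ?w * ?w) ^ k" by (simp add: z_def True power_mult_distrib)
    with True sum p show ?thesis by (simp add: dft_root_cnj)
  next
    case False
    \<comment> \<open>If \<open>z\<close> were 1, this would identify the \<open>k\<close>-th and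
      \<open>l\<close>-th powers of the root, contradicting \<open>dft_root_inj\<close>.\<close>
    have "?w ^ k * z = (cnj ?w * ?w) ^ k * ?w ^ l"
      by (simp add: z_def power_mult_distrib mult_ac)
    then have "?w ^ k * z = ?w ^ l" by (simp add: dft_root_cnj)
    with False dft_root_inj[OF k l] have "z \<noteq> 1" by auto
    moreover have "z ^ p = 1"
    proof -
      have "z ^ p = cnj ((?w ^ p) ^ k) * (?w ^ p) ^ l"
        by (simp add: z_def power_mult_distrib power_mult[symmetric] mult_ac)
      then show ?thesis using dft_root_unity[OF p] by simp
    qed
    ultimately show ?thesis using sum False by (simp add: geometric_sum)
  qed
qed

lemma block_dft_carrier:
  "block_dft m n p D \<in> carrier_mat (m * p) (n * p)"
  by (rule carrier_matI)
    (simp_all only: block_dft_def kronecker_def index_mult_mat dim_row_mat dim_col_mat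
      mat_adjoint_dim carrier_matD[OF dft_mat_carrier] index_one_mat mult.commute)

text \<open>The Kronecker factors act on the block index alone, so each block of the product is a
  linear combination of the \<open>D k\<close>. The coefficients found here drive the proofs about
  products, adjoints and circulant structure.\<close>

lemma block_dft_index:
  assumes D: "\<And>k. k < p \<Longrightarrow> D k \<in> carrier_mat m n"
    and a: "a < p" and b: "b < p" and i: "i < m" and j: "j < n"
  shows "block_dft m n p D $$ (a * m + i, b * n + j)
    = (\<Sum>k<p. dft_mat p $$ (a, k) * cnj (dft_mat p $$ (b, k)) * D k $$ (i, j))"
proof -
  let ?F = "dft_mat p"
  let ?L = "kronecker ?F (1\<^sub>m m)" and ?D = "diag_block_mat (map D [0..<p])"
    and ?R = "kronecker (mat_adjoint ?F) (1\<^sub>m n)"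
  have L: "?L \<in> carrier_mat (m * p) (m * p)" and R: "?R \<in> carrier_mat (n * p) (n * p)"
    by (simp_all add: kronecker_def dft_mat_def mult.commute)
  have Dc: "?D \<in> carrier_mat (m * p) (n * p)" by (rule diag_block_mat_carrier[OF D])
  have LD: "(?L * ?D) $$ (a * m + i, c * n + l) = ?F $$ (a, c) * D c $$ (i, l)"
    if "c < p" "l < n" for c l
  proof -
    have "(?L * ?D) $$ (a * m + i, c * n + l)
        = (\<Sum>k<p. \<Sum>q<m. (if i = q then ?F $$ (a, k) else 0) * (if k = c then D k $$ (q, l) else 0))"
      using index_mult_blocks[OF L Dc block_index_less[OF a i] block_index_less[OF that]]
        kronecker_one_index[OF dft_mat_carrier a _ i] diag_block_mat_index[OF D _ that(1) _ that(2)]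
      by simp
    also have "\<dots> = (\<Sum>k<p. if k = c then ?F $$ (a, c) * D c $$ (i, l) else 0)"
      using i by (intro sum.cong) (auto simp: if_distrib[where f = "\<lambda>x. x * _"] cong: if_cong)
    also have "\<dots> = ?F $$ (a, c) * D c $$ (i, l)" using that by simp
    finally show ?thesis .
  qed
  have "block_dft m n p D $$ (a * m + i, b * n + j)
      = (\<Sum>k<p. \<Sum>q<n. ?F $$ (a, k) * D k $$ (i, q) * (if q = j then mat_adjoint ?F $$ (k, b) else 0))"
    unfolding block_dft_def
    using index_mult_blocks[OF mult_carrier_mat[OF L Dc] R block_index_less[OF a i] block_index_less[OF b j]]
      LD kronecker_one_index[OF mat_adjoint_carrier[OF dft_mat_carrier] _ b _ j]
    by simp
  also have "\<dots> = (\<Sum>k<p. ?F $$ (a, k) * D k $$ (i, j) * mat_adjoint ?F $$ (k, b))"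
    using j by (intro sum.cong) (auto simp: if_distrib[where f = "\<lambda>x. _ * x"] cong: if_cong)
  also have "\<dots> = (\<Sum>k<p. ?F $$ (a, k) * cnj (?F $$ (b, k)) * D k $$ (i, j))"
    using dft_mat_carrier[of p] b by (intro sum.cong) auto
  finally show ?thesis .
qed

lemma block_dft_cong:
  assumes "\<And>k. k < p \<Longrightarrow> D k = E k"
  shows "block_dft m n p D = block_dft m n p E"
proof -
  have "map D [0..<p] = map E [0..<p]" using assms by simp
  then show ?thesis by (simp only: block_dft_def)
qed

text \<open>The inner Fourier factors cancel by orthonormality of the columns of
  \<open>dft_mat p\<close>, leaving blockwise products.\<close>

lemma block_dft_mult:
  assumes D: "\<And>k. k < p \<Longrightarrow> D k \<in> carrier_mat m n"
    and E: "\<And>k. k < p \<Longrightarrow> E k \<in> carrier_mat n s"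
  shows "block_dft m n p D * block_dft n s p E = block_dft m s p (\<lambda>k. D k * E k)"
proof (rule eq_block_matI)
  let ?F = "dft_mat p"
  fix a b i j
  assume a: "a < p" and b: "b < p" and i: "i < m" and j: "j < s"
  have DE: "D k * E k \<in> carrier_mat m s" if "k < p" for k
    using D[OF that] E[OF that] by simp
  have "(block_dft m n p D * block_dft n s p E) $$ (a * m + i, b * s + j)
    = (\<Sum>c<p. \<Sum>l<n. (\<Sum>k<p. ?F $$ (a, k) * cnj (?F $$ (c, k)) * D k $$ (i, l)) *
        (\<Sum>q<p. ?F $$ (c, q) * cnj (?F $$ (b, q)) * E q $$ (l, j)))"
    using index_mult_blocks[OF block_dft_carrier block_dft_carrier block_index_less[OF a i] block_index_less[OF b j]]
      block_dft_index[OF D a _ i] block_dft_index[OF E _ b _ j] by simp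
  \<comment> \<open>The factors depending on \<open>c\<close> are collected at the end; the
    following exchanges move the sum over \<open>c\<close> innermost, where it becomes a Kronecker
    delta.\<close>
  also have "\<dots> = (\<Sum>c<p. \<Sum>l<n. \<Sum>k<p. \<Sum>q<p. (?F $$ (a, k) * cnj (?F $$ (b, q)) * D k $$ (i, l) * E q $$ (l, j))
      * (cnj (?F $$ (c, k)) * ?F $$ (c, q)))"
    by (simp add: sum_product mult_ac)
  also have "\<dots> = (\<Sum>l<n. \<Sum>c<p. \<Sum>k<p. \<Sum>q<p. (?F $$ (a, k) * cnj (?F $$ (b, q)) * D k $$ (i, l) * E q $$ (l, j))
      * (cnj (?F $$ (c, k)) * ?F $$ (c, q)))"
    by (rule sum.swap)
  also have "\<dots> = (\<Sum>l<n. \<Sum>k<p. \<Sum>c<p. \<Sum>q<p. (?F $$ (a, k) * cnj (?F $$ (b, q)) * D k $$ (i, l) * E q $$ (l, j))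
      * (cnj (?F $$ (c, k)) * ?F $$ (c, q)))"
    by (intro sum.cong refl sum.swap)
  also have "\<dots> = (\<Sum>l<n. \<Sum>k<p. \<Sum>q<p. \<Sum>c<p. (?F $$ (a, k) * cnj (?F $$ (b, q)) * D k $$ (i, l) * E q $$ (l, j))
      * (cnj (?F $$ (c, k)) * ?F $$ (c, q)))"
    by (intro sum.cong refl sum.swap)
  also have "\<dots> = (\<Sum>l<n. \<Sum>k<p. \<Sum>q<p. (?F $$ (a, k) * cnj (?F $$ (b, q)) * D k $$ (i, l) * E q $$ (l, j))
      * (if k = q then 1 else 0))"
    by (intro sum.cong refl) (simp add: sum_distrib_left[symmetric] dft_mat_orthonormal)
  also have "\<dots> = (\<Sum>l<n. \<Sum>k<p. ?F $$ (a, k) * cnj (?F $$ (b, k)) * D k $$ (i, l) * E k $$ (l, j))"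
    by (intro sum.cong refl) (simp add: if_distrib[where f = "\<lambda>x. _ * x"] cong: if_cong)
  also have "\<dots> = (\<Sum>k<p. \<Sum>l<n. ?F $$ (a, k) * cnj (?F $$ (b, k)) * D k $$ (i, l) * E k $$ (l, j))"
    by (rule sum.swap)
  also have "\<dots> = (\<Sum>k<p. ?F $$ (a, k) * cnj (?F $$ (b, k)) * (D k * E k) $$ (i, j))"
  proof (intro sum.cong refl)
    fix k
    assume "k \<in> {..<p}"
    then have "D k \<in> carrier_mat m n" "E k \<in> carrier_mat n s" using D E by auto
    then show "(\<Sum>l<n. ?F $$ (a, k) * cnj (?F $$ (b, k)) * D k $$ (i, l) * E k $$ (l, j))
      = ?F $$ (a, k) * cnj (?F $$ (b, k)) * (D k * E k) $$ (i, j)"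
      using i j by (simp add: scalar_prod_def sum_distrib_left mult_ac atLeast0LessThan)
  qed
  also have "\<dots> = block_dft m s p (\<lambda>k. D k * E k) $$ (a * m + i, b * s + j)"
    using block_dft_index[OF DE a b i j] by simp
  finally show "(block_dft m n p D * block_dft n s p E) $$ (a * m + i, b * s + j)
    = block_dft m s p (\<lambda>k. D k * E k) $$ (a * m + i, b * s + j)" .
qed (rule mult_carrier_mat[OF block_dft_carrier block_dft_carrier] block_dft_carrier)+

lemma block_dft_adjoint:
  assumes D: "\<And>k. k < p \<Longrightarrow> D k \<in> carrier_mat m n"
  shows "mat_adjoint (block_dft m n p D) = block_dft n m p (\<lambda>k. mat_adjoint (D k))"
proof (rule eq_block_matI)
  fix a b i j
  assume a: "a < p" and b: "b < p" and i: "i < n" and j: "j < m"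
  have D': "mat_adjoint (D k) \<in> carrier_mat n m" if "k < p" for k using D[OF that] by simp
  have "mat_adjoint (D k) $$ (i, j) = cnj (D k $$ (j, i))" if "k < p" for k
    using D[OF that] i j by simp
  then show "mat_adjoint (block_dft m n p D) $$ (a * n + i, b * m + j)
      = block_dft n m p (\<lambda>k. mat_adjoint (D k)) $$ (a * n + i, b * m + j)"
    using block_dft_carrier[of m n p D] block_index_less[OF a i] block_index_less[OF b j] i j
      block_dft_index[OF D b a j i] block_dft_index[OF D' a b i j]
    by (auto intro!: sum.cong)
qed (use block_dft_carrier in auto)

text \<open>The rows of the DFT matrix are orthonormal as well, since its symmetry turns them into its
  columns.\<close>

lemma block_dft_one: "block_dft n n p (\<lambda>_. 1\<^sub>m n) = 1\<^sub>m (n * p)"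
proof (rule eq_block_matI)
  let ?F = "dft_mat p"
  fix a b i j
  assume a: "a < p" and b: "b < p" and i: "i < n" and j: "j < n"
  have sym: "?F $$ (x, k) = ?F $$ (k, x)" if "x < p" "k < p" for x k
    using that by (simp add: dft_mat_index mult.commute)
  have "(\<Sum>k<p. ?F $$ (a, k) * cnj (?F $$ (b, k))) = (\<Sum>k<p. cnj (?F $$ (k, b)) * ?F $$ (k, a))"
    using sym a b by (intro sum.cong) auto
  also have "\<dots> = (if b = a then 1 else 0)" by (rule dft_mat_orthonormal[OF b a])
  finally have "block_dft n n p (\<lambda>_. 1\<^sub>m n) $$ (a * n + i, b * n + j)
      = (if b = a then 1 else 0) * (if i = j then 1 else 0)"
    using block_dft_index[of p "\<lambda>_. 1\<^sub>m n" n n, OF _ a b i j] i j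
    by (simp add: sum_distrib_right[symmetric] split: if_splits)
  moreover have "a * n + i = b * n + j \<longleftrightarrow> a = b \<and> i = j"
    using i j by (metis add_left_cancel div_mult_self3 div_less mod_mult_self3 mod_less
        add.right_neutral neq0_conv less_zeroE)
  ultimately show "block_dft n n p (\<lambda>_. 1\<^sub>m n) $$ (a * n + i, b * n + j)
      = 1\<^sub>m (n * p) $$ (a * n + i, b * n + j)"
    using block_index_less[OF a i] block_index_less[OF b j] by auto
qed (auto intro: block_dft_carrier)

text \<open>The coefficient of \<open>D k\<close> in block \<open>(a, b)\<close> is, up to scaling,
  the power of the root with exponent \<open>(a - b) * k\<close>. It depends only on
  \<open>a - b\<close> modulo \<open>p\<close>, so the first block column provides the
  slices.\<close>

lemma block_dft_circulant:
  assumes D: "\<And>k. k < p \<Longrightarrow> D k \<in> carrier_mat m n" and p: "p > 0"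
  shows "\<exists>T\<in>carrier_tensor m n p. bcirc T = block_dft m n p D"
proof
  let ?w = "dft_root p" and ?F = "dft_mat p"
  define T where "T = map (\<lambda>k. mat m n (\<lambda>(i, j). block_dft m n p D $$ (k * m + i, j))) [0..<p]"
  show T: "T \<in> carrier_tensor m n p" by (auto simp: T_def carrier_tensor_def)
  show "bcirc T = block_dft m n p D"
  proof (rule eq_block_matI)
    fix a b i j
    assume a: "a < p" and b: "b < p" and i: "i < m" and j: "j < n"
    define c where "c = (a + p - b) mod p"
    have c: "c < p" using p by (simp add: c_def)
    have "bcirc T $$ (a * m + i, b * n + j) = block_dft m n p D $$ (c * m + i, 0 * n + j)"
      using bcirc_index[OF T a b i j] c i j by (simp add: T_def c_def)
    also have "\<dots> = (\<Sum>k<p. ?F $$ (c, k) * cnj (?F $$ (0, k)) * D k $$ (i, j))"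
      by (rule block_dft_index[OF D c p i j])
    also have "\<dots> = (\<Sum>k<p. ?F $$ (a, k) * cnj (?F $$ (b, k)) * D k $$ (i, j))"
    proof (intro sum.cong refl)
      fix k
      assume k: "k \<in> {..<p}"
      \<comment> \<open>Since \<open>c\<close> is \<open>a - b\<close> modulo \<open>p\<close>,
        periodicity and unit modulus give \<open>?w ^ c = ?w ^ a * cnj (?w ^ b)\<close>.\<close>
      have "c + b = a \<or> c + b = a + p" using a b by (auto simp: c_def mod_less_double)
      then have "?w ^ (c + b) = ?w ^ a"
        using dft_root_unity[OF p] by (metis mult.right_neutral power_add)
      then have "?w ^ a * cnj (?w ^ b) = ?w ^ c * (cnj ?w * ?w) ^ b"
        unfolding power_mult_distrib by (metis complex_cnj_power mult.assoc mult.commute power_add)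
      then have "?w ^ c = ?w ^ a * cnj (?w ^ b)" by (simp add: dft_root_cnj)
      then have "?w ^ (c * k) = ?w ^ (a * k) * cnj (?w ^ (b * k))"
        by (simp add: power_mult power_mult_distrib)
      then show "?F $$ (c, k) * cnj (?F $$ (0, k)) * D k $$ (i, j)
          = ?F $$ (a, k) * cnj (?F $$ (b, k)) * D k $$ (i, j)"
        using a b c k p by (simp add: dft_mat_index)
    qed
    also have "\<dots> = block_dft m n p D $$ (a * m + i, b * n + j)"
      using block_dft_index[OF D a b i j] by simp
    finally show "bcirc T $$ (a * m + i, b * n + j) = block_dft m n p D $$ (a * m + i, b * n + j)" .
  qed (use bcirc_carrier[OF T p] block_dft_carrier in auto)
qed

text \<open>Conjugation with Fourier matrices respects products and adjoints, hence the Penrose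
  equations can be verified block by block.\<close>

lemma is_mp_inverse_block_dft:
  assumes D: "\<And>k. k < p \<Longrightarrow> D k \<in> carrier_mat m n"
    and mp: "\<And>k. k < p \<Longrightarrow> is_mp_inverse (D k) (E k)"
  shows "is_mp_inverse (block_dft m n p D) (block_dft n m p E)"
proof -
  have E: "E k \<in> carrier_mat n m" if "k < p" for k
    using mp[OF that] D[OF that] by (simp add: is_mp_inverse_def)
  have DE: "D k * E k \<in> carrier_mat m m" and ED: "E k * D k \<in> carrier_mat n n" if "k < p" for k
    using D[OF that] E[OF that] by auto
  have "block_dft n m p E \<in> carrier_mat (dim_col (block_dft m n p D)) (dim_row (block_dft m n p D))"
    using block_dft_carrier[of m n p D] block_dft_carrier[of n m p E] by auto
  then show ?thesis
    using mp
    by (auto simp: is_mp_inverse_def block_dft_mult[OF D E] block_dft_mult[OF E D]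
        block_dft_mult[OF DE D] block_dft_mult[OF ED E] block_dft_adjoint[OF DE]
        block_dft_adjoint[OF ED] intro!: block_dft_cong)
qed

lemma block_dft_isometry:
  assumes D: "\<And>k. k < p \<Longrightarrow> D k \<in> carrier_mat m r"
    and iso: "\<And>k. k < p \<Longrightarrow> mat_adjoint (D k) * D k = 1\<^sub>m r"
  shows "mat_adjoint (block_dft m r p D) * block_dft m r p D = 1\<^sub>m (r * p)"
proof -
  have D': "mat_adjoint (D k) \<in> carrier_mat r m" if "k < p" for k using D[OF that] by simp
  have "mat_adjoint (block_dft m r p D) * block_dft m r p D
      = block_dft r r p (\<lambda>k. mat_adjoint (D k) * D k)"
    by (simp add: block_dft_adjoint[OF D] block_dft_mult[OF D' D])
  also have "\<dots> = block_dft r r p (\<lambda>_. 1\<^sub>m r)" by (rule block_dft_cong[OF iso])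
  finally show ?thesis by (simp add: block_dft_one)
qed

section \<open>The truncated factors\<close>

lemma first_cols_carrier:
  "A \<in> carrier_mat m n \<Longrightarrow> r \<le> n \<Longrightarrow> first_cols r A \<in> carrier_mat m r"
  by (auto simp: first_cols_def)

text \<open>The Gram matrix of the first \<open>r\<close> columns is the leading
  \<open>r\<close>-by-\<open>r\<close> part of the Gram matrix of \<open>U\<close>.\<close>

lemma first_cols_isometry:
  assumes U: "unitary_mat m U" and r: "r \<le> m"
  shows "mat_adjoint (first_cols r U) * first_cols r U = 1\<^sub>m r"
proof (rule eq_matI)
  have Uc: "U \<in> carrier_mat m m" and UU: "mat_adjoint U * U = 1\<^sub>m m"
    using U by (simp_all add: unitary_mat_def)
  note Rc = first_cols_carrier[OF Uc r]
  have ix: "first_cols r U $$ (i, j) = U $$ (i, j)" if "i < m" "j < r" for i j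
    using Uc r that by (simp add: first_cols_def mat_of_cols_index)
  fix i j
  assume "i < dim_row (1\<^sub>m r)" "j < dim_col (1\<^sub>m r)"
  then have i: "i < r" and j: "j < r" by auto
  have "(mat_adjoint (first_cols r U) * first_cols r U) $$ (i, j) = (mat_adjoint U * U) $$ (i, j)"
    using Uc Rc i j r ix by (simp add: scalar_prod_def)
  then show "(mat_adjoint (first_cols r U) * first_cols r U) $$ (i, j) = 1\<^sub>m r $$ (i, j)"
    using UU i j r by simp
qed (use U r first_cols_carrier[of U m m r] in \<open>auto simp: unitary_mat_def\<close>)

text \<open>The rank is the size of a maximal independent set of columns, and these lie in a space
  of dimension \<open>n\<close>.\<close>

lemma (in vec_space) rank_le_nr:
  assumes "A \<in> carrier_mat n nc"
  shows "rank A \<le> n"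
proof -
  obtain S where S: "maximal S (\<lambda>T. T \<subseteq> set (cols A) \<and> lin_indpt T)"
    using maximal_exists_superset[of "set (cols A)" "\<lambda>T. T \<subseteq> set (cols A) \<and> lin_indpt T" "{}"]
    by (metis List.finite_set empty_subsetI finite_lin_indpt2 finite.emptyI empty_iff)
  then have "S \<subseteq> carrier_vec n" "lin_indpt S"
    using cols_dim[of A] assms by (auto simp: maximal_def)
  then have "card S \<le> n" using li_le_dim(2)[OF fin_dim] dim_is_n by auto
  then show ?thesis using rank_card_indpt[OF assms S] by simp
qed

text \<open>Ensures that the truncations to \<open>r\<close> columns really have \<open>r\<close>
  columns: the maximum is attained by some block, whose rank is bounded by both of its
  dimensions.\<close>

lemma tubal_rank_le:
  assumes "p > 0" "\<And>i. i < p \<Longrightarrow> \<Sigma>s i \<in> carrier_mat m n"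
  shows "tubal_rank m p \<Sigma>s \<le> m" "tubal_rank m p \<Sigma>s \<le> n"
proof -
  have "tubal_rank m p \<Sigma>s \<in> (\<lambda>i. vec_space.rank m (\<Sigma>s i)) ` {..<p}"
    unfolding tubal_rank_def using assms(1) by (intro Max_in) auto
  then obtain i where "i < p" "tubal_rank m p \<Sigma>s = vec_space.rank m (\<Sigma>s i)" by auto
  then show "tubal_rank m p \<Sigma>s \<le> m" "tubal_rank m p \<Sigma>s \<le> n"
    using vec_space.rank_le_nr[OF assms(2)] vec_space.rank_le_nc[OF assms(2)] by auto
qed

theorem corollary6:
  fixes A U S V Ur Sr Vr :: "complex tensor"
    and Us Vs :: "nat \<Rightarrow> complex mat"
    and \<Sigma>s :: "nat \<Rightarrow> real mat"
    and m n p r :: nat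
  assumes "m > 0" and "n > 0" and "p > 0"
    and "A \<in> carrier_tensor m n p"
    and "real_tensor A"
    and "t_svd m n p A U S V Us \<Sigma>s Vs"
    and "r = tubal_rank m p \<Sigma>s"
    and "t_csvd m n p r A Ur Sr Vr Us \<Sigma>s Vs"
  shows "tensor_mp_inverse A = Vr *\<^sub>t tensor_mp_inverse Sr *\<^sub>t tensor_adjoint Ur"
proof -
  note p = \<open>p > 0\<close>
  have svd: "unitary_mat m (Us i)" "unitary_mat n (Vs i)" "\<Sigma>s i \<in> carrier_mat m n" if "i < p" for i
    using assms(6) that by (auto simp: t_svd_def)
  have r: "r \<le> m" "r \<le> n"
    using tubal_rank_le[of p \<Sigma>s m n] svd(3) p assms(7) by auto
  define D where "D i = mat_diag r (\<lambda>j. complex_of_real (\<Sigma>s i $$ (j, j)))" for i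
  \<comment> \<open>Blockwise candidates for the inverses of the \<open>D i\<close>; a vanishing
    singular value stays zero because \<open>inverse 0 = 0\<close>.\<close>
  define E where "E i = mat_diag r (\<lambda>j. inverse (complex_of_real (\<Sigma>s i $$ (j, j))))" for i
  have Ur: "Ur \<in> carrier_tensor m r p" and Sr: "Sr \<in> carrier_tensor r r p"
    and Vr: "Vr \<in> carrier_tensor n r p"
    and bU: "bcirc Ur = block_dft m r p (\<lambda>i. first_cols r (Us i))"
    and bS: "bcirc Sr = block_dft r r p D"
    and bV: "bcirc Vr = block_dft n r p (\<lambda>i. first_cols r (Vs i))"
    and A_eq: "A = Ur *\<^sub>t Sr *\<^sub>t tensor_adjoint Vr"
    using assms(8) unfolding t_csvd_def D_def by blast+
  have isoU: "mat_adjoint (bcirc Ur) * bcirc Ur = 1\<^sub>m (r * p)"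
    unfolding bU using svd(1) r
    by (intro block_dft_isometry first_cols_isometry[of m] first_cols_carrier[of _ _ m])
       (auto simp: unitary_mat_def)
  have isoV: "mat_adjoint (bcirc Vr) * bcirc Vr = 1\<^sub>m (r * p)"
    unfolding bV using svd(2) r
    by (intro block_dft_isometry first_cols_isometry[of n] first_cols_carrier[of _ _ n])
       (auto simp: unitary_mat_def)
  have "E k \<in> carrier_mat r r" for k by (simp add: E_def)
  \<comment> \<open>\<open>T\<close> is the tensor that turns out to be the Moore-Penrose inverse of
    \<open>Sr\<close>: the inverted blocks, conjugated by Fourier matrices, are again block
    circulant.\<close>
  then obtain T where T: "T \<in> carrier_tensor r r p" and bT: "bcirc T = block_dft r r p E"
    using block_dft_circulant[of p E r r] p by blast
  have mpS: "is_mp_inverse (bcirc Sr) (bcirc T)"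
    unfolding bS bT D_def E_def by (intro is_mp_inverse_block_dft is_mp_inverse_diag) simp
  have T_eq: "tensor_mp_inverse Sr = T" by (rule tensor_mp_inverse_eqI[OF Sr T p mpS])
  note Ua = tensor_adjoint_carrier[OF Ur p] and Va = tensor_adjoint_carrier[OF Vr p]
  note VT = tprod_carrier[OF Vr T p] and US = tprod_carrier[OF Ur Sr p]
  \<comment> \<open>Pushing \<open>bcirc\<close> through products and adjoints leaves the purely
    matricial situation of \<open>is_mp_inverse_isometry\<close>.\<close>
  have "is_mp_inverse (bcirc A) (bcirc (Vr *\<^sub>t T *\<^sub>t tensor_adjoint Ur))"
    unfolding A_eq bcirc_tprod[OF US Va p] bcirc_tprod[OF Ur Sr p] bcirc_tprod[OF VT Ua p]
      bcirc_tprod[OF Vr T p] bcirc_adjoint[OF Ur p] bcirc_adjoint[OF Vr p]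
    by (rule is_mp_inverse_isometry[OF bcirc_carrier[OF Ur p] isoU bcirc_carrier[OF Vr p] isoV
          bcirc_carrier[OF Sr p] mpS])
  then show ?thesis
    unfolding T_eq by (rule tensor_mp_inverse_eqI[OF assms(4) tprod_carrier[OF VT Ua p] p])
qed

end
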